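(* There exist a robust MDP $M=(\mathcal S,\mathcal A,r,\mathcal P,\gamma)$ with uncertainty set $\mathcal P=\{P^o,P'\}$ and discount factor $\gamma\in(\gamma_o,1)$, and a state $s_1\in\mathcal S$, such that $$V^{\pi^o}(s_1)\le V^{\pi^*}(s_1)-\frac{c}{1-\gamma},$$ where $c$ is a positive constant, $\pi^*$ is the optimal robust policy of $M$, and $\pi^o$ is the non-robust optimal policy when the model is $P^o$.
   Context: $\gamma_o\in(0,1)$ is a constant. $\mathcal S,\mathcal A$ are finite sets and $r:\mathcal S\times\mathcal A\to[0,1]$ is the reward function. A model $P=(P_{s,a})_{(s,a)}$ assigns to each $(s,a)\in\mathcal S\times\mathcal A$ a probability distribution $P_{s,a}$ on $\mathcal S$. For a deterministic policy $\pi:\mathcal S\to\mathcal A$, $V_{\pi,P}(s)=\mathbb E[\sum_{t\ge0}\gamma^tr(s_t,a_t)\mid s_0=s]$ with $a_t=\pi(s_t)$, $s_{t+1}\sim P_{s_t,a_t}$. The robust value of $\pi$ is $V^\pi(s)=\inf_{P\in\mathcal P}V_{\pi,P}(s)=\min\{V_{\pi,P^o}(s),V_{\pi,P'}(s)\}$. An optimal robust policy is a policy $\pi^*$ with $V^{\pi^*}(s)=\sup_\pi V^\pi(s)$ for all $s$. A non-robust optimal policy for $P^o$ is a policy $\pi^o$ with $V_{\pi^o,P^o}(s)=\max_\pi V_{\pi,P^o}(s)$ for all $s$. The uncertainty set is rectangular, i.e. $\mathcal P=\prod_{(s,a)}\mathcal P_{s,a}$, where $\mathcal P_{s,a}$ is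 a set of probability distributions on $\mathcal S$. *)

theory Defs
  imports "HOL-Probability.Probability"
begin

text \<open>A model assigns to every state-action pair the distribution of the next state.\<close>

type_synonym ('s, 'a) model = "'s \<times> 'a \<Rightarrow> 's pmf"

record ('s, 'a) rmdp =
  states :: "'s set"
  actions :: "'a set"
  reward :: "'s \<Rightarrow> 'a \<Rightarrow> real"
  uncertainty :: "('s, 'a) model set"
  discount :: real

text \<open>
  Models are extensional functions on \<open>states \<times> actions\<close>, so a rectangular uncertainty set is
  literally a product of sets of distributions on the states.
\<close>

definition rectangular :: "'s set \<Rightarrow> 'a set \<Rightarrow> ('s, 'a) model set \<Rightarrow> bool" where
  "rectangular S A U \<longleftrightarrow>
     (\<exists>Q :: 's \<times> 'a \<Rightarrow> 's pmf set.
        (\<forall>x \<in> S \<times> A. Q x \<subseteq> {p. set_pmf p \<subseteq> S}) \<and> U = Pi\<^sub>E (S \<times> A) Q)"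

definition robust_mdp :: "('s, 'a) rmdp \<Rightarrow> bool" where
  "robust_mdp M \<longleftrightarrow>
     finite (states M) \<and> states M \<noteq> {} \<and>
     finite (actions M) \<and> actions M \<noteq> {} \<and>
     (\<forall>s \<in> states M. \<forall>a \<in> actions M. 0 \<le> reward M s a \<and> reward M s a \<le> 1) \<and>
     uncertainty M \<noteq> {} \<and> rectangular (states M) (actions M) (uncertainty M) \<and>
     0 < discount M \<and> discount M < 1"

text \<open>Deterministic stationary policies, again as extensional functions.\<close>

definition policies :: "('s, 'a) rmdp \<Rightarrow> ('s \<Rightarrow> 'a) set" where
  "policies M = states M \<rightarrow>\<^sub>E actions M"

text \<open>
  The law of the state sequence \<open>s\<^sub>0, s\<^sub>1, \<dots>\<close> with \<open>s\<^sub>0 = s\<close> is obtained from the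
  Ionescu-Tulcea theorem; the kernel at time \<open>t\<close> receives the states before time \<open>t\<close>.
\<close>

definition step_kernel ::
  "('s, 'a) model \<Rightarrow> ('s \<Rightarrow> 'a) \<Rightarrow> 's \<Rightarrow> nat \<Rightarrow> (nat \<Rightarrow> 's) \<Rightarrow> 's measure" where
  "step_kernel P \<pi> s t \<omega> =
     (case t of 0 \<Rightarrow> measure_pmf (return_pmf s)
      | Suc n \<Rightarrow> measure_pmf (P (\<omega> n, \<pi> (\<omega> n))))"

definition trajectory ::
  "('s, 'a) model \<Rightarrow> ('s \<Rightarrow> 'a) \<Rightarrow> 's \<Rightarrow> (nat \<Rightarrow> 's) measure" where
  "trajectory P \<pi> s =
     projective_family.lim UNIV
       (Ionescu_Tulcea.CI (step_kernel P \<pi> s) (\<lambda>_. count_space UNIV)) (\<lambda>_. count_space UNIV)"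

lemma Ionescu_Tulcea_step_kernel:
  fixes P :: "('s, 'a) model"
  shows "Ionescu_Tulcea (step_kernel P \<pi> s) (\<lambda>_. count_space UNIV)"
proof (rule Ionescu_Tulcea.intro)
  fix t :: nat
  show "step_kernel P \<pi> s t \<in>
      measurable (PiM {0..<t} (\<lambda>_. count_space UNIV)) (subprob_algebra (count_space UNIV))"
  proof (cases t)
    case 0
    have "measure_pmf (return_pmf s) \<in> space (subprob_algebra (count_space UNIV))"
      by (simp add: space_subprob_algebra measure_pmf.subprob_space_axioms)
    then show ?thesis
      using 0 by (simp add: step_kernel_def[abs_def])
  next
    case (Suc n)
    have "(\<lambda>x. measure_pmf (P (x, \<pi> x))) \<in>
        measurable (count_space UNIV) (subprob_algebra (count_space UNIV))"
      by (simp add: space_subprob_algebra measure_pmf.subprob_space_axioms)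
    moreover have "(\<lambda>\<omega>. \<omega> n) \<in>
        measurable (PiM {0..<Suc n} (\<lambda>_. count_space UNIV)) (count_space UNIV)"
      by (rule measurable_component_singleton) simp
    ultimately show ?thesis
      using Suc measurable_compose by (fastforce simp: step_kernel_def[abs_def])
  qed
next
  fix t :: nat and \<omega> :: "nat \<Rightarrow> 's"
  show "prob_space (step_kernel P \<pi> s t \<omega>)"
    by (auto simp: step_kernel_def measure_pmf.prob_space_axioms split: nat.split)
qed

definition policy_value ::
  "('s, 'a) rmdp \<Rightarrow> ('s \<Rightarrow> 'a) \<Rightarrow> ('s, 'a) model \<Rightarrow> 's \<Rightarrow> real" where
  "policy_value M \<pi> P s =
     (LINT \<omega>|trajectory P \<pi> s. (\<Sum>t. discount M ^ t * reward M (\<omega> t) (\<pi> (\<omega> t))))"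

definition robust_value :: "('s, 'a) rmdp \<Rightarrow> ('s \<Rightarrow> 'a) \<Rightarrow> 's \<Rightarrow> real" where
  "robust_value M \<pi> s = (INF P \<in> uncertainty M. policy_value M \<pi> P s)"

definition optimal_robust_policy :: "('s, 'a) rmdp \<Rightarrow> ('s \<Rightarrow> 'a) \<Rightarrow> bool" where
  "optimal_robust_policy M \<pi> \<longleftrightarrow>
     \<pi> \<in> policies M \<and>
     (\<forall>s \<in> states M. robust_value M \<pi> s = (SUP \<pi>' \<in> policies M. robust_value M \<pi>' s))"

definition nonrobust_optimal_policy ::
  "('s, 'a) rmdp \<Rightarrow> ('s, 'a) model \<Rightarrow> ('s \<Rightarrow> 'a) \<Rightarrow> bool" where
  "nonrobust_optimal_policy M P \<pi> \<longleftrightarrow>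
     \<pi> \<in> policies M \<and>
     (\<forall>s \<in> states M. policy_value M \<pi> P s = Max ((\<lambda>\<pi>'. policy_value M \<pi>' P s) ` policies M))"

end

theory Submission
  imports Defs
begin

text \<open>
  In state \<open>0\<close> one action pays \<open>1\<close> and the other pays a constant \<open>r < 1\<close>; both keep the system in
  state \<open>0\<close>, except that under \<open>P'\<close> the first one leads to an absorbing state without reward. The
  policy that is optimal for \<open>P\<^sup>o\<close> takes the first action and has robust value at most \<open>1\<close>, while
  the second action guarantees \<open>r / (1 - \<gamma>)\<close>. For \<open>\<gamma> > \<gamma>\<^sub>o\<close>, the choice \<open>r = 1 - \<gamma>\<^sub>o / 2\<close> leaves
  a gap of at least \<open>(\<gamma>\<^sub>o / 2) / (1 - \<gamma>)\<close>. All transitions are deterministic, so every trajectory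
  measure is concentrated on a single orbit.
\<close>

section \<open>Deterministic trajectories\<close>

lemma measure_pmf_return_pmf: "measure_pmf (return_pmf x) = return (count_space UNIV) x"
  by (rule measure_eqI) (simp_all add: emeasure_return)

text \<open>Every step kernel along the orbit is a point mass, so by induction the law of each
  finite prefix is a point mass as well. The limit measure has these prefix laws as
  marginals.\<close>

lemma AE_trajectory_eq_orbit:
  assumes "orb 0 = s"
    and "\<And>t. P (orb t, \<pi> (orb t)) = return_pmf (orb (Suc t))"
  shows "AE \<omega> in trajectory P \<pi> s. \<forall>t. \<omega> t = orb t"
proof -
  let ?M = "\<lambda>_ :: nat. count_space UNIV :: 'a measure"
  interpret IT: Ionescu_Tulcea "step_kernel P \<pi> s" ?M
    by (rule Ionescu_Tulcea_step_kernel)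
  have step: "step_kernel P \<pi> s n (restrict orb {0..<n}) = return (count_space UNIV) (orb n)" for n
    using assms by (cases n) (simp_all add: step_kernel_def measure_pmf_return_pmf)
  \<comment> \<open>\<open>IT.C 0 n\<close> is the joint law of the coordinates before
    \<open>n\<close>. It starts from the empty history, whose only extensional representative is
    \<open>\<lambda>_. undefined\<close>.\<close>
  have C: "IT.C 0 n (\<lambda>_. undefined) = return (PiM {0..<n} ?M) (restrict orb {0..<n})" for n
  proof (induction n)
    case 0
    then show ?case
      by (simp add: restrict_def)
  next
    case (Suc n)
    have space: "restrict orb {0..<n} \<in> space (PiM {0..<n} ?M)"
      by (simp add: space_PiM)
    have upd: "(restrict orb {0..<n})(n := orb n) = restrict orb {0..<Suc n}"
      by (auto simp: restrict_def fun_eq_iff)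
    have meas: "fun_upd (restrict orb {0..<n}) n \<in> measurable (count_space UNIV) (PiM {0..<Suc n} ?M)"
      by (auto simp: space_PiM PiE_iff extensional_def)
    have "IT.C 0 (Suc n) (\<lambda>_. undefined) = IT.eP n (restrict orb {0..<n})"
      by (simp only: IT.C.simps Suc add_0 bind_return[OF IT.measurable_eP space])
    also have "\<dots> = return (PiM {0..<Suc n} ?M) (restrict orb {0..<Suc n})"
      unfolding IT.eP_def step by (subst distr_return[OF meas]) (simp_all add: upd)
    finally show ?case .
  qed
  \<comment> \<open>One time at a time: the marginal at \<open>t\<close> is the projection of a
    prefix law long enough to contain \<open>t\<close>. The countably many null sets are merged at
    the end.\<close>
  have "AE \<omega> in IT.PF.lim. \<omega> t = orb t" for t
  proof -
    let ?J = "{t}"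
    have t: "t < IT.up_to ?J"
      by (simp add: IT.up_to_less)
    have "restrict (restrict orb {0..<IT.up_to ?J}) ?J = restrict orb ?J"
      using t by (simp add: Int_absorb1)
    then have CI: "IT.CI ?J = return (PiM ?J ?M) (restrict orb ?J)"
      unfolding IT.CI_def C using t
      by (subst distr_return[OF measurable_restrict_subset]) (simp_all add: space_PiM)
    have pred: "Measurable.pred (PiM ?J ?M) (\<lambda>x. x t = orb t)"
      by measurable
    have "AE x in IT.CI ?J. x t = orb t"
      unfolding CI using AE_return[OF _ pred, of "restrict orb ?J"] by (simp add: space_PiM)
    then have "AE x in distr IT.PF.lim (PiM ?J ?M) (\<lambda>x. restrict x ?J). x t = orb t"
      by (subst IT.distr_lim) simp_all
    then show ?thesis
      by (subst (asm) AE_distr_iff)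
        (auto intro!: measurable_restrict measurable_component_singleton
          simp: measurable_cong_sets[OF IT.PF.sets_lim refl])
  qed
  then show ?thesis
    unfolding trajectory_def AE_all_countable by blast
qed

text \<open>The discounted sum is almost surely the constant given by the orbit, and integrating a
  constant against a probability measure returns it.\<close>

lemma policy_value_deterministic:
  assumes "orb 0 = s"
    and "\<And>t. P (orb t, \<pi> (orb t)) = return_pmf (orb (Suc t))"
  shows "policy_value M \<pi> P s = (\<Sum>t. discount M ^ t * reward M (orb t) (\<pi> (orb t)))"
proof -
  let ?M = "\<lambda>_ :: nat. count_space UNIV :: 'a measure"
  interpret IT: Ionescu_Tulcea "step_kernel P \<pi> s" ?M
    by (rule Ionescu_Tulcea_step_kernel)
  interpret prob_space "trajectory P \<pi> s"
    unfolding trajectory_def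
  proof (rule prob_spaceI)
    \<comment> \<open>The cylinder over the empty index set is the whole space, so the total mass is
      that of the marginal with no coordinates.\<close>
    interpret CI: prob_space "IT.CI {}"
      by (rule IT.PF.prob_space_P) simp_all
    have "emeasure IT.PF.lim (IT.PF.emb UNIV {} (space (PiM {} ?M))) = emeasure (IT.CI {}) (space (PiM {} ?M))"
      by (rule IT.lim) simp_all
    moreover have "IT.PF.emb UNIV {} (space (PiM {} ?M)) = space IT.PF.lim"
      by (auto simp: prod_emb_def space_PiM)
    ultimately show "emeasure IT.PF.lim (space IT.PF.lim) = 1"
      using CI.emeasure_space_1 by (simp add: IT.PF.space_P)
  qed
  have sets: "sets (trajectory P \<pi> s) = sets (PiM UNIV ?M)"
    by (simp add: trajectory_def)
  have "(\<lambda>\<omega>. \<Sum>t. discount M ^ t * reward M (\<omega> t) (\<pi> (\<omega> t))) \<in> borel_measurable (PiM UNIV ?M)"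
  proof (intro borel_measurable_suminf borel_measurable_times borel_measurable_const)
    fix t
    show "(\<lambda>\<omega>. reward M (\<omega> t) (\<pi> (\<omega> t))) \<in> borel_measurable (PiM UNIV ?M)"
      by (rule measurable_compose[OF measurable_component_singleton,
            where g = "\<lambda>x. reward M x (\<pi> x)"]) simp_all
  qed
  then have "policy_value M \<pi> P s =
      (LINT \<omega>|trajectory P \<pi> s. (\<Sum>t. discount M ^ t * reward M (orb t) (\<pi> (orb t))))"
    unfolding policy_value_def using AE_trajectory_eq_orbit[OF assms]
    by (intro integral_cong_AE) (auto simp: measurable_cong_sets[OF sets refl])
  then show ?thesis
    by (simp add: prob_space)
qed

section \<open>The two-state example\<close>

text \<open>\<open>k\<close> is the successor of state 0 under action 0: \<open>trap_model 0\<close>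
  plays the role of \<open>P\<^sup>o\<close>, \<open>trap_model 1\<close> that of \<open>P'\<close>.
  The restriction makes the models extensional, as elements of a product must be.\<close>

definition trap_model :: "nat \<Rightarrow> (nat, nat) model" where
  "trap_model k =
     restrict (\<lambda>(s, a). return_pmf (if s = 0 \<and> a = 0 then k else s)) ({0, 1} \<times> {0, 1})"

definition trap_mdp :: "real \<Rightarrow> real \<Rightarrow> (nat, nat) rmdp" where
  "trap_mdp r \<gamma> =
     \<lparr>states = {0, 1}, actions = {0, 1},
      reward = (\<lambda>s a. if s = 0 then if a = 0 then 1 else r else 0),
      uncertainty = {trap_model 0, trap_model 1}, discount = \<gamma>\<rparr>"

text \<open>The two models differ only at the pair (0, 0). The product with two choices there and
  one choice elsewhere has exactly these two elements.\<close>

lemma rectangular_trap_models: "rectangular {0, 1} {0, 1} {trap_model 0, trap_model 1}"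
  unfolding rectangular_def
proof (intro exI conjI)
  let ?Q = "\<lambda>(s :: nat, a :: nat).
    if s = 0 \<and> a = 0 then {return_pmf 0, return_pmf (1 :: nat)} else {return_pmf s}"
  show "\<forall>x \<in> {0, 1} \<times> {0, 1}. ?Q x \<subseteq> {p. set_pmf p \<subseteq> {0, 1}}"
    by auto
  show "{trap_model 0, trap_model 1} = Pi\<^sub>E ({0, 1} \<times> {0, 1}) ?Q"
  proof
    show "{trap_model 0, trap_model 1} \<subseteq> Pi\<^sub>E ({0, 1} \<times> {0, 1}) ?Q"
      by (auto simp: trap_model_def)
    show "Pi\<^sub>E ({0, 1} \<times> {0, 1}) ?Q \<subseteq> {trap_model 0, trap_model 1}"
    proof
      fix P assume P: "P \<in> Pi\<^sub>E ({0, 1} \<times> {0, 1}) ?Q"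
      then have "P (0, 0) \<in> ?Q (0, 0)"
        by (rule PiE_mem) simp
      then obtain k where k: "k \<in> {0, 1}" "P (0, 0) = return_pmf k"
        by auto
      have "P = trap_model k"
      proof (rule PiE_ext[OF P])
        show "trap_model k \<in> Pi\<^sub>E ({0, 1} \<times> {0, 1}) ?Q"
          using k(1) by (auto simp: trap_model_def)
        fix x :: "nat \<times> nat" assume x: "x \<in> {0, 1} \<times> {0, 1}"
        then have "P x \<in> ?Q x"
          using P by (rule PiE_mem[rotated])
        with x k show "P x = trap_model k x"
          by (auto simp: trap_model_def)
      qed
      with k(1) show "P \<in> {trap_model 0, trap_model 1}"
        by auto
    qed
  qed
qed

lemma robust_mdp_trap:
  assumes "0 \<le> r" "r \<le> 1" "0 < \<gamma>" "\<gamma> < 1"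
  shows "robust_mdp (trap_mdp r \<gamma>)"
  using assms rectangular_trap_models by (simp add: robust_mdp_def trap_mdp_def)

section \<open>Values of the policies\<close>

lemma policies_trap: "policies (trap_mdp r \<gamma>) = {0, 1} \<rightarrow>\<^sub>E {0, 1}"
  by (simp add: policies_def trap_mdp_def)

lemma finite_policies_trap: "finite (policies (trap_mdp r \<gamma>))"
  by (simp add: policies_trap finite_PiE)

text \<open>Optimality is demanded at every state, so the absorbing state must be evaluated too;
  there all policies tie.\<close>

lemma policy_value_trap_1:
  assumes "\<pi> \<in> policies (trap_mdp r \<gamma>)"
  shows "policy_value (trap_mdp r \<gamma>) \<pi> (trap_model k) 1 = 0"
proof -
  have "\<pi> 1 \<in> {0, 1}"
    using assms unfolding policies_trap by (rule PiE_mem) simp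
  then show ?thesis
    by (subst policy_value_deterministic[where orb = "\<lambda>_. 1"])
      (auto simp: trap_model_def trap_mdp_def)
qed

text \<open>Without a jump to state 1 the same reward recurs forever and gives a geometric series.
  Action 0 under \<open>trap_model 1\<close> is rewarded once, at time 0, before the system is
  trapped.\<close>

lemma policy_value_trap_0:
  assumes "\<pi> \<in> policies (trap_mdp r \<gamma>)" "0 < \<gamma>" "\<gamma> < 1"
  shows "policy_value (trap_mdp r \<gamma>) \<pi> (trap_model 0) 0 = (if \<pi> 0 = 0 then 1 else r) / (1 - \<gamma>)"
    and "policy_value (trap_mdp r \<gamma>) \<pi> (trap_model 1) 0 = (if \<pi> 0 = 0 then 1 else r / (1 - \<gamma>))"
proof -
  have \<pi>: "\<pi> 0 \<in> {0, 1}"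
    using assms(1) unfolding policies_trap by (rule PiE_mem) simp
  have geo: "(\<Sum>t. \<gamma> ^ t * x) = x / (1 - \<gamma>)" for x
    using assms(2,3) by (simp add: suminf_mult2[symmetric] summable_geometric suminf_geometric)
  show "policy_value (trap_mdp r \<gamma>) \<pi> (trap_model 0) 0 = (if \<pi> 0 = 0 then 1 else r) / (1 - \<gamma>)"
    using \<pi> geo[of 1] geo[of r]
    by (subst policy_value_deterministic[where orb = "\<lambda>_. 0"])
      (auto simp: trap_model_def trap_mdp_def)
  show "policy_value (trap_mdp r \<gamma>) \<pi> (trap_model 1) 0 = (if \<pi> 0 = 0 then 1 else r / (1 - \<gamma>))"
  proof (cases "\<pi> 0 = 0")
    case True
    let ?orb = "\<lambda>t :: nat. if t = 0 then 0 else 1 :: nat"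
    have \<pi>1: "\<pi> 1 \<in> {0, 1}"
      using assms(1) unfolding policies_trap by (rule PiE_mem) simp
    have "policy_value (trap_mdp r \<gamma>) \<pi> (trap_model 1) 0 =
        (\<Sum>t. discount (trap_mdp r \<gamma>) ^ t * reward (trap_mdp r \<gamma>) (?orb t) (\<pi> (?orb t)))"
      using True \<pi>1 by (intro policy_value_deterministic) (auto simp: trap_model_def)
    also have "\<dots> = (\<Sum>t. if t = 0 then 1 else 0)"
      using True by (intro arg_cong[where f = suminf]) (auto simp: trap_mdp_def)
    also have "\<dots> = 1"
      by (subst suminf_finite[of "{0}"]) auto
    finally show ?thesis
      using True by simp
  next
    case False
    then show ?thesis
      using \<pi> geo[of r]
      by (subst policy_value_deterministic[where orb = "\<lambda>_. 0"])
        (auto simp: trap_model_def trap_mdp_def)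
  qed
qed

lemma robust_value_trap:
  "robust_value (trap_mdp r \<gamma>) \<pi> s =
    min (policy_value (trap_mdp r \<gamma>) \<pi> (trap_model 0) s)
        (policy_value (trap_mdp r \<gamma>) \<pi> (trap_model 1) s)"
proof -
  have "uncertainty (trap_mdp r \<gamma>) = {trap_model 0, trap_model 1}"
    by (simp add: trap_mdp_def)
  then show ?thesis
    by (simp add: robust_value_def cInf_eq_Min)
qed

lemma robust_value_trap_1:
  assumes "\<pi> \<in> policies (trap_mdp r \<gamma>)"
  shows "robust_value (trap_mdp r \<gamma>) \<pi> 1 = 0"
  using assms by (simp only: robust_value_trap policy_value_trap_1 min.idem)

lemma robust_value_trap_0:
  assumes "\<pi> \<in> policies (trap_mdp r \<gamma>)" "0 < \<gamma>" "\<gamma> < 1"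
  shows "robust_value (trap_mdp r \<gamma>) \<pi> 0 = (if \<pi> 0 = 0 then 1 else r / (1 - \<gamma>))"
proof -
  \<comment> \<open>For action 0 the worse of the two models is thus \<open>trap_model 1\<close>;
    for action 1 the models agree.\<close>
  have "1 \<le> 1 / (1 - \<gamma>)"
    using assms(2,3) by simp
  then show ?thesis
    by (simp only: robust_value_trap policy_value_trap_0[OF assms]) simp
qed

section \<open>Optimal policies\<close>

lemma optimal_robust_trap:
  assumes "0 < \<gamma>" "\<gamma> < 1" "1 \<le> r / (1 - \<gamma>)"
  shows "optimal_robust_policy (trap_mdp r \<gamma>) (restrict (\<lambda>_. 1) {0, 1})"
proof -
  let ?M = "trap_mdp r \<gamma>" and ?\<pi> = "restrict (\<lambda>_. 1) {0, 1} :: nat \<Rightarrow> nat"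
  have \<pi>: "?\<pi> \<in> policies ?M"
    by (auto simp: policies_trap)
  \<comment> \<open>At state 0 the two possible robust values are 1 and
    \<open>r / (1 - \<gamma>)\<close>, which the third assumption compares.\<close>
  have "robust_value ?M \<pi>' s \<le> robust_value ?M ?\<pi> s" if "s \<in> {0, 1}" "\<pi>' \<in> policies ?M" for s \<pi>'
    using that \<pi> assms by (auto simp only: robust_value_trap_0 robust_value_trap_1 insert_iff) auto
  then have "robust_value ?M ?\<pi> s = (SUP \<pi>' \<in> policies ?M. robust_value ?M \<pi>' s)"
    if "s \<in> {0, 1}" for s
    using that \<pi> by (intro cSup_eq_maximum[symmetric]) auto
  with \<pi> show ?thesis
    by (simp add: optimal_robust_policy_def trap_mdp_def)
qed

lemma nonrobust_optimal_trap:
  assumes "0 < \<gamma>" "\<gamma> < 1" "r \<le> 1"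
  shows "nonrobust_optimal_policy (trap_mdp r \<gamma>) (trap_model 0) (restrict (\<lambda>_. 0) {0, 1})"
proof -
  let ?M = "trap_mdp r \<gamma>" and ?\<pi> = "restrict (\<lambda>_. 0) {0, 1} :: nat \<Rightarrow> nat"
  have \<pi>: "?\<pi> \<in> policies ?M"
    by (auto simp: policies_trap)
  have "policy_value ?M \<pi>' (trap_model 0) s \<le> policy_value ?M ?\<pi> (trap_model 0) s"
    if "s \<in> {0, 1}" "\<pi>' \<in> policies ?M" for s \<pi>'
    using that \<pi> assms
    by (auto simp only: policy_value_trap_0 policy_value_trap_1 insert_iff) (auto simp: divide_right_mono)
  then have "policy_value ?M ?\<pi> (trap_model 0) s =
      Max ((\<lambda>\<pi>'. policy_value ?M \<pi>' (trap_model 0) s) ` policies ?M)" if "s \<in> {0, 1}" for s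
    using that \<pi> finite_policies_trap by (intro Max_eqI[symmetric]) auto
  with \<pi> show ?thesis
    by (simp add: nonrobust_optimal_policy_def trap_mdp_def)
qed

text \<open>The loss is claimed for every optimal policy of \<open>trap_model 0\<close>. Optimal
  policies may differ at state 1, but the strict inequality \<open>r < 1\<close> fixes their action
  at state 0.\<close>

lemma nonrobust_optimal_trap_0:
  assumes "0 < \<gamma>" "\<gamma> < 1" "r < 1"
    and opt: "nonrobust_optimal_policy (trap_mdp r \<gamma>) (trap_model 0) \<pi>"
  shows "\<pi> 0 = 0"
proof (rule ccontr)
  assume "\<pi> 0 \<noteq> 0"
  let ?M = "trap_mdp r \<gamma>" and ?\<pi> = "restrict (\<lambda>_. 0) {0, 1} :: nat \<Rightarrow> nat"
  have \<pi>: "?\<pi> \<in> policies ?M"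
    by (auto simp: policies_trap)
  have "\<pi> \<in> policies ?M" and
    "policy_value ?M \<pi> (trap_model 0) 0 = Max ((\<lambda>\<pi>'. policy_value ?M \<pi>' (trap_model 0) 0) ` policies ?M)"
    using opt by (simp_all add: nonrobust_optimal_policy_def trap_mdp_def)
  moreover have "policy_value ?M ?\<pi> (trap_model 0) 0 \<le> \<dots>"
    using \<pi> finite_policies_trap by (intro Max_ge) auto
  ultimately have "1 / (1 - \<gamma>) \<le> r / (1 - \<gamma>)"
    using \<pi> assms(1,2) \<open>\<pi> 0 \<noteq> 0\<close> by (simp add: policy_value_trap_0)
  with assms show False
    by (simp add: divide_le_cancel)
qed

section \<open>Choice of the reward and size of the gap\<close>

theorem theorem4:
  fixes \<gamma>\<^sub>o :: real
  assumes "0 < \<gamma>\<^sub>o" and "\<gamma>\<^sub>o < 1"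
  shows "\<exists>c > 0. \<forall>\<gamma> \<in> {\<gamma>\<^sub>o<..<1}.
    \<exists>(M :: (nat, nat) rmdp) P\<^sub>o P' s\<^sub>1.
      robust_mdp M \<and> uncertainty M = {P\<^sub>o, P'} \<and> discount M = \<gamma> \<and> s\<^sub>1 \<in> states M \<and>
      (\<exists>\<pi>\<^sub>r. optimal_robust_policy M \<pi>\<^sub>r) \<and>
      (\<exists>\<pi>\<^sub>o. nonrobust_optimal_policy M P\<^sub>o \<pi>\<^sub>o) \<and>
      (\<forall>\<pi>\<^sub>r \<pi>\<^sub>o. optimal_robust_policy M \<pi>\<^sub>r \<longrightarrow> nonrobust_optimal_policy M P\<^sub>o \<pi>\<^sub>o \<longrightarrow>
         robust_value M \<pi>\<^sub>o s\<^sub>1 \<le> robust_value M \<pi>\<^sub>r s\<^sub>1 - c / (1 - \<gamma>))"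
\<comment> \<open>The constant is fixed before the discount factor and depends on
  \<open>\<gamma>\<^sub>o\<close> alone.\<close>
proof (intro exI[of _ "\<gamma>\<^sub>o / 2"] conjI ballI)
  show "0 < \<gamma>\<^sub>o / 2"
    using assms by simp
  fix \<gamma> assume "\<gamma> \<in> {\<gamma>\<^sub>o<..<1}"
  with assms have \<gamma>: "0 < \<gamma>" "\<gamma> < 1" "\<gamma>\<^sub>o < \<gamma>"
    by auto
  define r where "r = 1 - \<gamma>\<^sub>o / 2"
  have r: "0 \<le> r" "r < 1"
    using assms by (auto simp: r_def)
  \<comment> \<open>Multiplied by \<open>1 - \<gamma>\<close>, this reads
    \<open>1 - \<gamma> \<le> 1 - \<gamma>\<^sub>o\<close>: the reward gives up one half of
    \<open>\<gamma>\<^sub>o\<close> and the constant takes the other.\<close>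
  have gap: "1 \<le> r / (1 - \<gamma>) - (\<gamma>\<^sub>o / 2) / (1 - \<gamma>)"
    unfolding diff_divide_distrib[symmetric] r_def using \<gamma> by (simp add: pos_le_divide_eq)
  moreover have "0 \<le> (\<gamma>\<^sub>o / 2) / (1 - \<gamma>)"
    using assms \<gamma> by simp
  ultimately have r1: "1 \<le> r / (1 - \<gamma>)"
    by linarith
  let ?M = "trap_mdp r \<gamma>" and ?\<pi> = "restrict (\<lambda>_. 1) {0, 1} :: nat \<Rightarrow> nat"
  have loss: "robust_value ?M \<pi>\<^sub>o 0 \<le> robust_value ?M \<pi>\<^sub>r 0 - (\<gamma>\<^sub>o / 2) / (1 - \<gamma>)"
    if opt_r: "optimal_robust_policy ?M \<pi>\<^sub>r"
      and opt_o: "nonrobust_optimal_policy ?M (trap_model 0) \<pi>\<^sub>o" for \<pi>\<^sub>r \<pi>\<^sub>o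
  proof -
    have "\<pi>\<^sub>o \<in> policies ?M"
      using opt_o by (simp add: nonrobust_optimal_policy_def)
    then have "robust_value ?M \<pi>\<^sub>o 0 = 1"
      using \<gamma> r nonrobust_optimal_trap_0[OF _ _ _ opt_o] by (simp add: robust_value_trap_0)
    \<comment> \<open>Both policies attain the same supremum, so an arbitrary robust optimum can be
      replaced by the explicit one.\<close>
    moreover have "robust_value ?M \<pi>\<^sub>r 0 = robust_value ?M ?\<pi> 0"
      using opt_r optimal_robust_trap[OF \<gamma>(1,2) r1]
      by (simp add: optimal_robust_policy_def trap_mdp_def)
    moreover have "robust_value ?M ?\<pi> 0 = r / (1 - \<gamma>)"
      using \<gamma> by (subst robust_value_trap_0) (auto simp: policies_trap)
    ultimately show ?thesis
      using gap by simp
  qed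
  show "\<exists>(M :: (nat, nat) rmdp) P\<^sub>o P' s\<^sub>1.
      robust_mdp M \<and> uncertainty M = {P\<^sub>o, P'} \<and> discount M = \<gamma> \<and> s\<^sub>1 \<in> states M \<and>
      (\<exists>\<pi>\<^sub>r. optimal_robust_policy M \<pi>\<^sub>r) \<and>
      (\<exists>\<pi>\<^sub>o. nonrobust_optimal_policy M P\<^sub>o \<pi>\<^sub>o) \<and>
      (\<forall>\<pi>\<^sub>r \<pi>\<^sub>o. optimal_robust_policy M \<pi>\<^sub>r \<longrightarrow> nonrobust_optimal_policy M P\<^sub>o \<pi>\<^sub>o \<longrightarrow>
         robust_value M \<pi>\<^sub>o s\<^sub>1 \<le> robust_value M \<pi>\<^sub>r s\<^sub>1 - (\<gamma>\<^sub>o / 2) / (1 - \<gamma>))"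
  proof (intro exI conjI allI impI)
    show "robust_mdp ?M"
      using \<gamma> r by (simp add: robust_mdp_trap)
    show "uncertainty ?M = {trap_model 0, trap_model 1}" "discount ?M = \<gamma>" "0 \<in> states ?M"
      by (simp_all add: trap_mdp_def)
    show "optimal_robust_policy ?M ?\<pi>"
      using \<gamma> r1 by (rule_tac optimal_robust_trap)
    show "nonrobust_optimal_policy ?M (trap_model 0) (restrict (\<lambda>_. 0) {0, 1})"
      using \<gamma> r by (intro nonrobust_optimal_trap) auto
  qed (rule loss)
qed

end
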